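(* Let $\mathcal{K}(\mathbb{M}_2)\cong\mathbb{R}^6$ be the space of Killing $2$-tensors of the Minkowski plane with coordinates $(A,B,C,\alpha,\beta,\gamma)$, and let $G_M$ and $S_5$ be as defined in the context. The line $S_5$, formed by the (non-characteristic) tensors of the form $\tau\,\mathbf{g}$ with $\tau\in\mathbb{R}$, is a connected orbit of the action of $G_M$.
   Context: In the Minkowski plane $\mathbb{M}_2$ with pseudo-Cartesian coordinates $(t,x)$ and metric $\mathbf{g}$ with contravariant components $\mathrm{diag}(1,-1)$, the general Killing $2$-tensor has contravariant components $K^{11}=A+2\alpha x+\gamma x^2$, $K^{12}=K^{21}=C+\alpha t+\beta x+\gamma tx$, $K^{22}=B+2\beta t+\gamma t^2$, with $A,B,C,\alpha,\beta,\gamma\in\mathbb{R}$. So the vector space $\mathcal{K}(\mathbb{M}_2)$ of Killing $2$-tensors is identified with $\mathbb{R}^6$ with coordinates $(A,B,C,\alpha,\beta,\gamma)$. A Killing $2$-tensor is called characteristic if its eigenvalues are real and simple and its eigenvectors are normal (orthogonally integrable). With respect to $(\partial_A,\partial_B,\partial_C,\partial_\alpha,\partial_\beta,\partial_\gamma)$ define the vector fields on $\mathcal{K}(\mathbb{M}_2)$: $V_1=(0,-2\beta,-\alpha,0,-\gamma,0)$ and $V_2=(-2\alpha,0,-\beta,-\gamma,0,0)$ (translations); $V_3=(2C,2C,A+B,\beta,\alpha,0)$ (boost); $V_4=(2A,2B,2C,\alpha,\beta,0)$ (dilatation of the plane); $V_5=(1,-1,0,0,0,0)$ (addition of a multiple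 of the metric); $V_6=(A,B,C,\alpha,\beta,\gamma)$ (scalar multiplication). Discrete transformations of $\mathcal{K}(\mathbb{M}_2)$ (unlisted coordinates are unchanged): $R_0:\mathbf{K}\mapsto-\mathbf{K}$; $R_1: C\mapsto-C,\ \alpha\mapsto-\alpha$; $R_2: C\mapsto-C,\ \beta\mapsto-\beta$. $G_M$ is the group of transformations of $\mathcal{K}(\mathbb{M}_2)$ generated by the flows of $V_1,\dots,V_6$ and by $R_0,R_1,R_2$. $S_5=\{\alpha=\beta=\gamma=0,\ B=-A,\ C=0\}$. *)

theory Defs
  imports
    "HOL-Analysis.Analysis"
    "HOL-Computational_Algebra.Polynomial"
    "HOL-Algebra.Generated_Groups"
    "HOL-Algebra.Group_Action"
begin

section \<open>Killing tensors of the Minkowski plane\<close>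

text \<open>
  A point of the plane is \<open>p = (t, x)\<close> with \<open>t = p $ 1\<close> and \<open>x = p $ 2\<close>.  A 2-tensor field is given
  by the matrix of its components in these pseudo-Cartesian coordinates.
\<close>

type_synonym tensor_field = "real^2 \<Rightarrow> real^2^2"

definition metric_contra :: "real^2^2"
  where "metric_contra = (\<chi> i j. if i = j then (if i = 1 then 1 else - 1) else 0)"

definition metric_cov :: "real^2^2"
  where "metric_cov = (\<chi> i j. if i = j then (if i = 1 then 1 else - 1) else 0)"

text \<open>
  The Levi-Civita connection is flat in these coordinates, so the Killing equation
  \<open>\<nabla>\<^sub>(\<^sub>k K\<^sub>i\<^sub>j\<^sub>) = 0\<close> only involves partial derivatives of the covariant components
  \<open>K\<^sub>i\<^sub>j = g\<^sub>i\<^sub>a K\<^sup>a\<^sup>b g\<^sub>b\<^sub>j\<close>.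
\<close>

definition is_killing :: "tensor_field \<Rightarrow> bool"
  where "is_killing K \<longleftrightarrow>
    (\<forall>p. transpose (K p) = K p) \<and>
    (\<exists>D. \<forall>p. ((\<lambda>q. metric_cov ** K q ** metric_cov) has_derivative D p) (at p) \<and>
      (\<forall>i j k. D p (axis k 1) $ i $ j + D p (axis i 1) $ j $ k + D p (axis j 1) $ k $ i = 0))"

text \<open>The coordinates \<open>(A, B, C, \<alpha>, \<beta>, \<gamma>)\<close> on the space of Killing tensors.\<close>

type_synonym killing_coords = "real \<times> real \<times> real \<times> real \<times> real \<times> real"

definition killing_tensor :: "killing_coords \<Rightarrow> tensor_field"
  where "killing_tensor = (\<lambda>(A, B, C, \<alpha>, \<beta>, \<gamma>) p. let t = p $ 1; x = p $ 2 in
    (\<chi> i j. if i = 1 \<and> j = 1 then A + 2 * \<alpha> * x + \<gamma> * x\<^sup>2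
            else if i = 2 \<and> j = 2 then B + 2 * \<beta> * t + \<gamma> * t\<^sup>2
            else C + \<alpha> * t + \<beta> * x + \<gamma> * t * x))"

lemma killing_tensor_nth:
  "killing_tensor (A, B, C, \<alpha>, \<beta>, \<gamma>) p $ 1 $ 1 = A + 2 * \<alpha> * p $ 2 + \<gamma> * (p $ 2)\<^sup>2"
  "killing_tensor (A, B, C, \<alpha>, \<beta>, \<gamma>) p $ 1 $ 2 = C + \<alpha> * p $ 1 + \<beta> * p $ 2 + \<gamma> * p $ 1 * p $ 2"
  "killing_tensor (A, B, C, \<alpha>, \<beta>, \<gamma>) p $ 2 $ 1 = C + \<alpha> * p $ 1 + \<beta> * p $ 2 + \<gamma> * p $ 1 * p $ 2"
  "killing_tensor (A, B, C, \<alpha>, \<beta>, \<gamma>) p $ 2 $ 2 = B + 2 * \<beta> * p $ 1 + \<gamma> * (p $ 1)\<^sup>2"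
  by (simp_all add: killing_tensor_def Let_def)

lemma lowered_nth:
  fixes M :: "real^2^2"
  shows "(metric_cov ** M ** metric_cov) $ i $ j = (if i = j then M $ i $ j else - M $ i $ j)"
  using exhaust_2[of i] exhaust_2[of j]
  by (auto simp: metric_cov_def matrix_matrix_mult_def sum_2)

lemma lowered_eq:
  fixes M :: "real^2^2"
  shows "metric_cov ** M ** metric_cov = (\<chi> i j. if i = j then M $ i $ j else - M $ i $ j)"
  by (simp add: vec_eq_iff lowered_nth)

lemma is_killing_killing_tensor: "is_killing (killing_tensor c)"
proof -
  obtain A B C \<alpha> \<beta> \<gamma> where c: "c = (A, B, C, \<alpha>, \<beta>, \<gamma>)" by (cases c)
  have sym: "transpose (killing_tensor c p) = killing_tensor c p" for p
    by (simp add: c vec_eq_iff transpose_def forall_2 killing_tensor_nth)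
  define D :: "real^2 \<Rightarrow> real^2 \<Rightarrow> real^2^2" where "D = (\<lambda>p v. \<chi> i j.
      if i = 1 \<and> j = 1 then 2 * (\<alpha> + \<gamma> * p $ 2) * v $ 2
      else if i = 2 \<and> j = 2 then 2 * (\<beta> + \<gamma> * p $ 1) * v $ 1
      else - ((\<alpha> + \<gamma> * p $ 2) * v $ 1 + (\<beta> + \<gamma> * p $ 1) * v $ 2))"
  have der: "((\<lambda>q. metric_cov ** killing_tensor c q ** metric_cov) has_derivative D p) (at p)" for p
  proof -
    have comp: "((\<lambda>q. (metric_cov ** killing_tensor c q ** metric_cov) $ i $ j)
        has_derivative (\<lambda>v. D p v $ i $ j)) (at p)" for i j
      using exhaust_2[of i] exhaust_2[of j] unfolding lowered_nth
      by (elim disjE)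
        (auto simp: c killing_tensor_nth D_def algebra_simps
          intro!: derivative_eq_intros bounded_linear_imp_has_derivative[OF bounded_linear_vec_nth])
    show ?thesis
      by (subst has_derivative_componentwise_within) (use comp in \<open>auto simp: Basis_vec_def inner_axis\<close>)
  qed
  have "\<forall>i j k. D p (axis k 1) $ i $ j + D p (axis i 1) $ j $ k + D p (axis j 1) $ k $ i = 0" for p
    by (simp add: forall_2 D_def axis_def)
  with sym der show ?thesis unfolding is_killing_def by blast
qed

lemma inj_killing_tensor: "inj killing_tensor"
proof (rule injI)
  fix c c' assume eq: "killing_tensor c = killing_tensor c'"
  obtain A B C \<alpha> \<beta> \<gamma> where c: "c = (A, B, C, \<alpha>, \<beta>, \<gamma>)" by (cases c)
  obtain A' B' C' \<alpha>' \<beta>' \<gamma>' where c': "c' = (A', B', C', \<alpha>', \<beta>', \<gamma>')" by (cases c')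
  have e: "killing_tensor c (vector [t, x]) $ i $ j = killing_tensor c' (vector [t, x]) $ i $ j"
    for t x i j using eq by simp
  show "c = c'"
    using e[of 0 0 1 1] e[of 0 0 1 2] e[of 0 0 2 2] e[of 0 1 1 1] e[of 0 "-1" 1 1]
      e[of 1 0 2 2] e[of "-1" 0 2 2] by (simp add: c c' killing_tensor_nth)
qed

lemma killing_imp_killing_tensor:
  assumes "is_killing K"
  shows "K \<in> range killing_tensor"
proof -
  have sym: "transpose (K p) = K p" for p using assms by (simp add: is_killing_def)
  obtain D where der: "\<And>p. ((\<lambda>q. metric_cov ** K q ** metric_cov) has_derivative D p) (at p)"
    and kil: "\<And>p i j k. D p (axis k 1) $ i $ j + D p (axis i 1) $ j $ k + D p (axis j 1) $ k $ i = 0"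
    using assms unfolding is_killing_def by metis
  define P where "P = (\<lambda>t x. vector [t, x] :: real^2)"
  define a where "a = (\<lambda>t x. K (P t x) $ 1 $ 1)"
  define u where "u = (\<lambda>t x. K (P t x) $ 1 $ 2)"
  define b where "b = (\<lambda>t x. K (P t x) $ 2 $ 2)"
  have lin: "linear (D p)" for p using der has_derivative_linear by blast
  have P2: "K (P t x) $ 2 $ 1 = u t x" for t x
    using arg_cong[OF sym[of "P t x"], of "\<lambda>M. M $ 1 $ 2"] by (simp add: transpose_def u_def)
  have PAff: "P t x = t *\<^sub>R axis 1 1 + x *\<^sub>R axis 2 1" for t x
    by (simp add: P_def vec_eq_iff forall_2 axis_def)
  have PT: "((\<lambda>t. P t x) has_derivative (\<lambda>s. s *\<^sub>R axis 1 1)) (at t)"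
    and PX: "((\<lambda>x. P t x) has_derivative (\<lambda>s. s *\<^sub>R axis 2 1)) (at x)" for t x
    unfolding PAff by (auto intro!: derivative_eq_intros)
  have dT: "((\<lambda>t. (metric_cov ** K (P t x) ** metric_cov) $ i $ j)
      has_real_derivative D (P t x) (axis 1 1) $ i $ j) (at t)" for t x i j
  proof -
    have "((\<lambda>t. (metric_cov ** K (P t x) ** metric_cov)) has_derivative
        (\<lambda>s. D (P t x) (s *\<^sub>R axis 1 1))) (at t)"
      by (rule has_derivative_compose[OF PT der])
    then have "((\<lambda>t. (metric_cov ** K (P t x) ** metric_cov) $ i $ j) has_derivative
        (\<lambda>s. D (P t x) (s *\<^sub>R axis 1 1) $ i $ j)) (at t)"
      by (intro bounded_linear.has_derivative[OF bounded_linear_vec_nth])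
    moreover have "(\<lambda>s. D (P t x) (s *\<^sub>R axis 1 1) $ i $ j) = (*) (D (P t x) (axis 1 1) $ i $ j)"
      by (simp add: linear_scale[OF lin] fun_eq_iff)
    ultimately show ?thesis by (simp add: has_field_derivative_def)
  qed
  have dX: "((\<lambda>x. (metric_cov ** K (P t x) ** metric_cov) $ i $ j)
      has_real_derivative D (P t x) (axis 2 1) $ i $ j) (at x)" for t x i j
  proof -
    have "((\<lambda>x. (metric_cov ** K (P t x) ** metric_cov)) has_derivative
        (\<lambda>s. D (P t x) (s *\<^sub>R axis 2 1))) (at x)"
      by (rule has_derivative_compose[OF PX der])
    then have "((\<lambda>x. (metric_cov ** K (P t x) ** metric_cov) $ i $ j) has_derivative
        (\<lambda>s. D (P t x) (s *\<^sub>R axis 2 1) $ i $ j)) (at x)"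
      by (intro bounded_linear.has_derivative[OF bounded_linear_vec_nth])
    moreover have "(\<lambda>s. D (P t x) (s *\<^sub>R axis 2 1) $ i $ j) = (*) (D (P t x) (axis 2 1) $ i $ j)"
      by (simp add: linear_scale[OF lin] fun_eq_iff)
    ultimately show ?thesis by (simp add: has_field_derivative_def)
  qed
  define f where "f = (\<lambda>t x. D (P t x) (axis 2 1) $ 1 $ 1)"
  define h where "h = (\<lambda>t x. D (P t x) (axis 1 1) $ 2 $ 2)"
  have aT: "((\<lambda>t. a t x) has_real_derivative 0) (at t)" for t x
    using dT[of x 1 1 t] kil[of "P t x" 1 1 1] by (simp add: lowered_nth a_def)
  have bX: "((\<lambda>x. b t x) has_real_derivative 0) (at x)" for t x
    using dX[of t 2 2 x] kil[of "P t x" 2 2 2] by (simp add: lowered_nth b_def)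
  have aX: "((\<lambda>x. a t x) has_real_derivative f t x) (at x)" for t x
    using dX[of t 1 1 x] by (simp add: lowered_nth a_def f_def)
  have bT: "((\<lambda>t. b t x) has_real_derivative h t x) (at t)" for t x
    using dT[of x 2 2 t] by (simp add: lowered_nth b_def h_def)
  have uT12: "((\<lambda>t. - u t x) has_real_derivative D (P t x) (axis 1 1) $ 1 $ 2) (at t)" for t x
    using dT[of x 1 2 t] by (simp add: lowered_nth u_def)
  have uT21: "((\<lambda>t. - u t x) has_real_derivative D (P t x) (axis 1 1) $ 2 $ 1) (at t)" for t x
    using dT[of x 2 1 t] by (simp add: lowered_nth P2)
  have uX12: "((\<lambda>x. - u t x) has_real_derivative D (P t x) (axis 2 1) $ 1 $ 2) (at x)" for t x
    using dX[of t 1 2 x] by (simp add: lowered_nth u_def)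
  have uX21: "((\<lambda>x. - u t x) has_real_derivative D (P t x) (axis 2 1) $ 2 $ 1) (at x)" for t x
    using dX[of t 2 1 x] by (simp add: lowered_nth P2)
  have uT: "((\<lambda>t. u t x) has_real_derivative f t x / 2) (at t)" for t x
  proof -
    have "D (P t x) (axis 1 1) $ 1 $ 2 = - f t x / 2"
      using DERIV_unique[OF uT12 uT21, of t x] kil[of "P t x" 1 1 2] by (simp add: f_def)
    then show ?thesis using DERIV_minus[OF uT12[of x t]] by simp
  qed
  have uX: "((\<lambda>x. u t x) has_real_derivative h t x / 2) (at x)" for t x
  proof -
    have "D (P t x) (axis 2 1) $ 1 $ 2 = - h t x / 2"
      using DERIV_unique[OF uX12 uX21, of t x] kil[of "P t x" 1 2 2] by (simp add: h_def)
    then show ?thesis using DERIV_minus[OF uX12[of t x]] by simp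
  qed
  have a0: "a t x = a 0 x" for t x
    by (rule DERIV_isconst_all[of "\<lambda>t. a t x"]) (use aT in blast)
  have b0: "b t x = b t 0" for t x
    by (rule DERIV_isconst_all[of "\<lambda>x. b t x"]) (use bX in blast)
  have f0: "f t x = f 0 x" for t x
    using aX[of t x] aX[of 0 x] a0 DERIV_unique by (metis (no_types, lifting) ext)
  have h0: "h t x = h t 0" for t x
    using bT[of x t] bT[of 0 t] b0 DERIV_unique by (metis (no_types, lifting) ext)
  have ut: "u t x = u 0 x + f 0 x / 2 * t" for t x
  proof -
    have "((\<lambda>t. u t x - f 0 x / 2 * t) has_real_derivative 0) (at t)" for t
      using uT[of x t] f0[of t x] by (auto intro!: derivative_eq_intros)
    from DERIV_isconst_all[of "\<lambda>t. u t x - f 0 x / 2 * t" t 0] this show ?thesis by auto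
  qed
  have ux: "u t x = u t 0 + h t 0 / 2 * x" for t x
  proof -
    have "((\<lambda>x. u t x - h t 0 / 2 * x) has_real_derivative 0) (at x)" for x
      using uX[of t x] h0[of t x] by (auto intro!: derivative_eq_intros)
    from DERIV_isconst_all[of "\<lambda>x. u t x - h t 0 / 2 * x" x 0] this show ?thesis by auto
  qed
  define \<alpha> where "\<alpha> = f 0 0 / 2"
  define \<beta> where "\<beta> = h 0 0 / 2"
  define \<gamma> where "\<gamma> = (h 1 0 - h 0 0) / 2"
  have u1: "u t x = u 0 0 + \<beta> * x + f 0 x / 2 * t" for t x
    using ut[of t x] ux[of 0 x] by (simp add: \<beta>_def)
  have u2: "u t x = u 0 0 + \<alpha> * t + h t 0 / 2 * x" for t x
    using ux[of t x] ut[of t 0] by (simp add: \<alpha>_def)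
  have fx: "f 0 x = 2 * \<alpha> + 2 * \<gamma> * x" for x
    using u1[of 1 x] u2[of 1 x] by (simp add: \<gamma>_def \<beta>_def field_simps)
  have ht: "h t 0 = 2 * \<beta> + 2 * \<gamma> * t" for t
    using u1[of t 1] u2[of t 1] fx[of 1] by (simp add: field_simps)
  have ax: "a t x = a 0 0 + 2 * \<alpha> * x + \<gamma> * x\<^sup>2" for t x
  proof -
    have "((\<lambda>x. a 0 x - (2 * \<alpha> * x + \<gamma> * x\<^sup>2)) has_real_derivative 0) (at x)" for x
      using aX[of 0 x] fx[of x] by (auto intro!: derivative_eq_intros)
    from DERIV_isconst_all[of "\<lambda>x. a 0 x - (2 * \<alpha> * x + \<gamma> * x\<^sup>2)" x 0] this a0[of t x]
    show ?thesis by auto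
  qed
  have bt: "b t x = b 0 0 + 2 * \<beta> * t + \<gamma> * t\<^sup>2" for t x
  proof -
    have "((\<lambda>t. b t 0 - (2 * \<beta> * t + \<gamma> * t\<^sup>2)) has_real_derivative 0) (at t)" for t
      using bT[of 0 t] ht[of t] by (auto intro!: derivative_eq_intros)
    from DERIV_isconst_all[of "\<lambda>t. b t 0 - (2 * \<beta> * t + \<gamma> * t\<^sup>2)" t 0] this b0[of t x]
    show ?thesis by auto
  qed
  have "K p = killing_tensor (a 0 0, b 0 0, u 0 0, \<alpha>, \<beta>, \<gamma>) p" for p
  proof -
    have p: "p = P (p $ 1) (p $ 2)" by (simp add: P_def vec_eq_iff forall_2)
    have "K p $ 1 $ 1 = a (p $ 1) (p $ 2)" "K p $ 1 $ 2 = u (p $ 1) (p $ 2)"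
      "K p $ 2 $ 1 = u (p $ 1) (p $ 2)" "K p $ 2 $ 2 = b (p $ 1) (p $ 2)"
      using p P2[of "p $ 1" "p $ 2"] by (simp_all add: a_def u_def b_def)
    moreover have "u (p $ 1) (p $ 2) = u 0 0 + \<alpha> * p $ 1 + \<beta> * p $ 2 + \<gamma> * p $ 1 * p $ 2"
      using u1[of "p $ 1" "p $ 2"] fx[of "p $ 2"] by (simp add: algebra_simps)
    ultimately show ?thesis
      by (simp add: vec_eq_iff forall_2 killing_tensor_nth ax[of "p $ 1" "p $ 2"] bt[of "p $ 1" "p $ 2"])
  qed
  then show ?thesis by blast
qed

theorem bij_betw_killing_tensor: "bij_betw killing_tensor UNIV {K. is_killing K}"
  unfolding bij_betw_def
  using inj_killing_tensor is_killing_killing_tensor killing_imp_killing_tensor by auto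

section \<open>Characteristic tensors\<close>

text \<open>
  Eigenvalues and eigenvectors are those of the endomorphism \<open>K\<^sup>i\<^sub>j = K\<^sup>i\<^sup>k g\<^sub>k\<^sub>j\<close>; the characteristic
  polynomial is taken over the complex numbers so that non-real eigenvalues are seen.
\<close>

definition mixed :: "tensor_field \<Rightarrow> real^2 \<Rightarrow> real^2^2"
  where "mixed K p = K p ** metric_cov"

definition charpoly :: "real^2^2 \<Rightarrow> complex poly"
  where "charpoly M = det (\<chi> i j. (if i = j then [:0, 1:] else 0) - [:complex_of_real (M $ i $ j):])"

definition real_simple_eigenvalues :: "real^2^2 \<Rightarrow> bool"
  where "real_simple_eigenvalues M \<longleftrightarrow>
    (\<forall>z. poly (charpoly M) z = 0 \<longrightarrow> z \<in> \<real> \<and> Polynomial.order z (charpoly M) = 1)"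

definition C1_on :: "(real^2) set \<Rightarrow> (real^2 \<Rightarrow> real^2) \<Rightarrow> bool"
  where "C1_on W X \<longleftrightarrow> (\<exists>X' :: real^2 \<Rightarrow> (real^2) \<Rightarrow>\<^sub>L (real^2).
    continuous_on W X' \<and> (\<forall>p\<in>W. (X has_derivative blinfun_apply (X' p)) (at p)))"

definition eigenvector_field_on :: "(real^2) set \<Rightarrow> tensor_field \<Rightarrow> (real^2 \<Rightarrow> real^2) \<Rightarrow> bool"
  where "eigenvector_field_on W K X \<longleftrightarrow>
    C1_on W X \<and> (\<forall>p\<in>W. X p \<noteq> 0 \<and> (\<exists>\<mu>. mixed K p *v X p = \<mu> *\<^sub>R X p))"

text \<open>
  A nonvanishing field \<open>X\<close> is normal if it is locally orthogonal to the level curves of functions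
  without critical points: near every point \<open>dh = f \<cdot> X\<^sup>\<flat>\<close> with \<open>f\<close> continuous and nowhere zero.
  Here \<open>X\<^sup>\<flat>\<close> has components \<open>g\<^sub>i\<^sub>j X\<^sup>j\<close>.
\<close>

definition normal_on :: "(real^2) set \<Rightarrow> (real^2 \<Rightarrow> real^2) \<Rightarrow> bool"
  where "normal_on W X \<longleftrightarrow>
    (\<forall>p\<in>W. \<exists>N f (h :: real^2 \<Rightarrow> real). open N \<and> p \<in> N \<and> N \<subseteq> W \<and> continuous_on N f \<and>
      (\<forall>q\<in>N. f q \<noteq> 0 \<and> (h has_derivative (\<lambda>v. f q * ((metric_cov *v X q) \<bullet> v))) (at q)))"

definition characteristic_on :: "(real^2) set \<Rightarrow> tensor_field \<Rightarrow> bool"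
  where "characteristic_on U K \<longleftrightarrow>
    is_killing K \<and>
    (\<forall>p\<in>U. real_simple_eigenvalues (mixed K p)) \<and>
    (\<forall>W X. open W \<and> W \<subseteq> U \<and> eigenvector_field_on W K X \<longrightarrow> normal_on W X)"

text \<open>
  The eigenvalues of a Killing tensor may coalesce or become complex on part of the plane, so the
  conditions are only required on some nonempty open region.
\<close>

definition characteristic :: "tensor_field \<Rightarrow> bool"
  where "characteristic K \<longleftrightarrow> (\<exists>U. open U \<and> U \<noteq> {} \<and> characteristic_on U K)"

section \<open>The transformation group\<close>

definition V1 :: "killing_coords \<Rightarrow> killing_coords"
  where "V1 = (\<lambda>(A, B, C, \<alpha>, \<beta>, \<gamma>). (0, - 2 * \<beta>, - \<alpha>, 0, - \<gamma>, 0))"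

definition V2 :: "killing_coords \<Rightarrow> killing_coords"
  where "V2 = (\<lambda>(A, B, C, \<alpha>, \<beta>, \<gamma>). (- 2 * \<alpha>, 0, - \<beta>, - \<gamma>, 0, 0))"

definition V3 :: "killing_coords \<Rightarrow> killing_coords"
  where "V3 = (\<lambda>(A, B, C, \<alpha>, \<beta>, \<gamma>). (2 * C, 2 * C, A + B, \<beta>, \<alpha>, 0))"

definition V4 :: "killing_coords \<Rightarrow> killing_coords"
  where "V4 = (\<lambda>(A, B, C, \<alpha>, \<beta>, \<gamma>). (2 * A, 2 * B, 2 * C, \<alpha>, \<beta>, 0))"

definition V5 :: "killing_coords \<Rightarrow> killing_coords"
  where "V5 = (\<lambda>(A, B, C, \<alpha>, \<beta>, \<gamma>). (1, - 1, 0, 0, 0, 0))"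

definition V6 :: "killing_coords \<Rightarrow> killing_coords"
  where "V6 = (\<lambda>(A, B, C, \<alpha>, \<beta>, \<gamma>). (A, B, C, \<alpha>, \<beta>, \<gamma>))"

definition R0 :: "killing_coords \<Rightarrow> killing_coords"
  where "R0 = (\<lambda>(A, B, C, \<alpha>, \<beta>, \<gamma>). (- A, - B, - C, - \<alpha>, - \<beta>, - \<gamma>))"

definition R1 :: "killing_coords \<Rightarrow> killing_coords"
  where "R1 = (\<lambda>(A, B, C, \<alpha>, \<beta>, \<gamma>). (A, B, - C, - \<alpha>, \<beta>, \<gamma>))"

definition R2 :: "killing_coords \<Rightarrow> killing_coords"
  where "R2 = (\<lambda>(A, B, C, \<alpha>, \<beta>, \<gamma>). (A, B, - C, \<alpha>, - \<beta>, \<gamma>))"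

definition is_flow :: "(killing_coords \<Rightarrow> killing_coords) \<Rightarrow> (real \<Rightarrow> killing_coords \<Rightarrow> killing_coords) \<Rightarrow> bool"
  where "is_flow V \<phi> \<longleftrightarrow>
    (\<forall>c. \<phi> 0 c = c) \<and>
    (\<forall>r s c. \<phi> (r + s) c = \<phi> r (\<phi> s c)) \<and>
    (\<forall>s c. ((\<lambda>s. \<phi> s c) has_vector_derivative V (\<phi> s c)) (at s))"

definition G_M_generators :: "(killing_coords \<Rightarrow> killing_coords) set"
  where "G_M_generators =
    {\<phi> s | V \<phi> s. V \<in> {V1, V2, V3, V4, V5, V6} \<and> is_flow V \<phi>} \<union> {R0, R1, R2}"

definition G_M :: "(killing_coords \<Rightarrow> killing_coords) monoid"
  where "G_M = (BijGroup UNIV)\<lparr>carrier := generate (BijGroup UNIV) G_M_generators\<rparr>"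

text \<open>The six vector fields are complete, so each of them contributes generators.\<close>

lemma is_flow_V1:
  "is_flow V1 (\<lambda>s (A, B, C, \<alpha>, \<beta>, \<gamma>). (A, B - 2 * \<beta> * s + \<gamma> * s\<^sup>2, C - \<alpha> * s, \<alpha>, \<beta> - \<gamma> * s, \<gamma>))"
  unfolding is_flow_def V1_def
  by (auto simp: power2_eq_square algebra_simps zero_prod_def
      intro!: has_vector_derivative_Pair has_vector_derivative_const derivative_eq_intros)

lemma is_flow_V2:
  "is_flow V2 (\<lambda>s (A, B, C, \<alpha>, \<beta>, \<gamma>). (A - 2 * \<alpha> * s + \<gamma> * s\<^sup>2, B, C - \<beta> * s, \<alpha> - \<gamma> * s, \<beta>, \<gamma>))"
  unfolding is_flow_def V2_def
  by (auto simp: power2_eq_square algebra_simps zero_prod_def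
      intro!: has_vector_derivative_Pair has_vector_derivative_const derivative_eq_intros)

lemma is_flow_V3:
  "is_flow V3 (\<lambda>s (A, B, C, \<alpha>, \<beta>, \<gamma>).
    ((A - B) / 2 + (A + B) / 2 * cosh (2 * s) + C * sinh (2 * s),
     (B - A) / 2 + (A + B) / 2 * cosh (2 * s) + C * sinh (2 * s),
     C * cosh (2 * s) + (A + B) / 2 * sinh (2 * s),
     \<alpha> * cosh s + \<beta> * sinh s, \<beta> * cosh s + \<alpha> * sinh s, \<gamma>))"
  unfolding is_flow_def V3_def
  by (auto simp: has_real_derivative_iff_has_vector_derivative[symmetric]
      cosh_add sinh_add distrib_left field_simps
      intro!: has_vector_derivative_Pair derivative_eq_intros)

lemma is_flow_V4:
  "is_flow V4 (\<lambda>s (A, B, C, \<alpha>, \<beta>, \<gamma>).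
    (exp (2 * s) * A, exp (2 * s) * B, exp (2 * s) * C, exp s * \<alpha>, exp s * \<beta>, \<gamma>))"
  unfolding is_flow_def V4_def
  by (auto simp: has_real_derivative_iff_has_vector_derivative[symmetric] exp_add distrib_left
      intro!: has_vector_derivative_Pair derivative_eq_intros)

lemma is_flow_V5:
  "is_flow V5 (\<lambda>s (A, B, C, \<alpha>, \<beta>, \<gamma>). (A + s, B - s, C, \<alpha>, \<beta>, \<gamma>))"
  unfolding is_flow_def V5_def
  by (auto simp: has_real_derivative_iff_has_vector_derivative[symmetric] zero_prod_def
      intro!: has_vector_derivative_Pair derivative_eq_intros)

lemma is_flow_V6: "is_flow V6 (\<lambda>s c. exp s *\<^sub>R c)"
  unfolding is_flow_def V6_def
  by (auto simp: exp_add has_real_derivative_iff_has_vector_derivative[symmetric]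
      intro!: has_vector_derivative_Pair derivative_eq_intros)

lemma group_G_M: "group G_M"
proof -
  have flow: "bij (\<phi> s)" if "is_flow V \<phi>" for V \<phi> s
  proof (rule o_bij[of "\<phi> (- s)"])
    show "\<phi> (- s) \<circ> \<phi> s = id" "\<phi> s \<circ> \<phi> (- s) = id"
      using that unfolding is_flow_def fun_eq_iff comp_def id_def
      by (metis add.left_inverse, metis add.right_inverse)
  qed
  have "bij R0" "bij R1" "bij R2"
    by (rule o_bij[of R0 R0] o_bij[of R1 R1] o_bij[of R2 R2];
        simp add: R0_def R1_def R2_def fun_eq_iff)+
  with flow have "G_M_generators \<subseteq> carrier (BijGroup UNIV)"
    unfolding G_M_generators_def BijGroup_def Bij_def by auto
  then show ?thesis unfolding G_M_def
    by (intro subgroup.subgroup_is_group group.generate_is_subgroup group_BijGroup)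
qed

definition S5 :: "killing_coords set"
  where "S5 = {(A, B, C, \<alpha>, \<beta>, \<gamma>). \<alpha> = 0 \<and> \<beta> = 0 \<and> \<gamma> = 0 \<and> B = - A \<and> C = 0}"

end

theory Submission
  imports Defs
begin

text \<open>
  The line \<open>S5\<close> is the common zero set of the linear forms \<open>A + B\<close>, \<open>C\<close>, \<open>\<alpha>\<close>, \<open>\<beta>\<close>, \<open>\<gamma>\<close> on the space of
  Killing tensors.  A tensor \<open>\<tau> g\<close> acts on vectors as \<open>\<tau>\<close> times the identity, so its eigenvalue is
  double at every point and it cannot be characteristic.

  For the orbit, transitivity is immediate: \<open>V5\<close> is the constant field directed along the line,
  and its flow translates the origin to every point of \<open>S5\<close>.  Invariance is the other half.  Each of
  the fields \<open>V1, ..., V6\<close> is tangent to \<open>S5\<close>, and in fact the defining forms, or suitable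
  combinations of them, can be ordered so that along any integral curve starting on \<open>S5\<close> each one
  satisfies \<open>f' = k f\<close>, \<open>f 0 = 0\<close> once the earlier ones are known to vanish; such an \<open>f\<close> is zero
  (\<open>zero_if_deriv_proportional\<close>).  This uses only the differential equation, hence applies to every
  flow of the given fields without comparing it with an explicit solution.  A flow map that
  sends \<open>S5\<close> into itself at all times, negative ones included, maps \<open>S5\<close> onto itself; the
  reflections are involutions preserving \<open>S5\<close>.  So all generators lie in the setwise stabiliser of
  \<open>S5\<close>, which is closed under composition and inversion.
\<close>

section \<open>The line of multiples of the metric\<close>

lemma S5_eq_range: "S5 = range (\<lambda>\<tau>. (\<tau>, - \<tau>, 0, 0, 0, 0))"
  by (auto simp: S5_def)

lemma S5_eq_span: "S5 = span {(1, - 1, 0, 0, 0, 0)}"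
  by (simp add: S5_eq_range span_singleton)

lemma subspace_S5: "subspace S5"
  by (simp add: S5_eq_span)

lemma dim_S5: "dim S5 = 1"
  by (simp add: S5_eq_span zero_prod_def)

lemma connected_S5: "connected S5"
  by (simp add: convex_connected subspace_imp_convex subspace_S5)

lemma killing_tensor_metric:
  "killing_tensor (\<tau>, - \<tau>, 0, 0, 0, 0) = (\<lambda>p. \<tau> *\<^sub>R metric_contra)"
  by (simp add: fun_eq_iff vec_eq_iff forall_2 killing_tensor_nth metric_contra_def)

lemma killing_tensor_image_S5:
  "killing_tensor ` S5 = range (\<lambda>\<tau> :: real. \<lambda>p :: real^2. \<tau> *\<^sub>R metric_contra)"
  by (simp add: S5_eq_range image_image killing_tensor_metric)

lemma charpoly_mixed_metric:
  "charpoly (mixed (\<lambda>p. \<tau> *\<^sub>R metric_contra) p) = [:- complex_of_real \<tau>, 1:] ^ 2"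
  by (simp add: charpoly_def mixed_def det_2 matrix_matrix_mult_def sum_2
      metric_contra_def metric_cov_def power2_eq_square)

text \<open>
  The eigenvalue \<open>\<tau>\<close> is double at every point of the plane, so no open region however small makes
  the tensor characteristic.
\<close>

lemma not_characteristic_metric: "\<not> characteristic (\<lambda>p. \<tau> *\<^sub>R metric_contra)"
proof
  assume "characteristic (\<lambda>p. \<tau> *\<^sub>R metric_contra)"
  then obtain p where simple: "real_simple_eigenvalues (mixed (\<lambda>p. \<tau> *\<^sub>R metric_contra) p)"
    unfolding characteristic_def characteristic_on_def by blast
  have "Polynomial.order (complex_of_real \<tau>) ([:- complex_of_real \<tau>, 1:] ^ 2) = 2"
    by (rule order_power_n_n)
  with simple show False
    unfolding real_simple_eigenvalues_def charpoly_mixed_metric by auto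
qed

section \<open>Invariance of the line\<close>

text \<open>The integrating factor \<open>exp (- k s)\<close> turns a solution of \<open>f' = k f\<close> into a constant.\<close>

lemma zero_if_deriv_proportional:
  fixes f :: "real \<Rightarrow> real"
  assumes deriv: "\<And>s. (f has_real_derivative k * f s) (at s)" and init: "f 0 = 0"
  shows "f s = 0"
proof -
  have "((\<lambda>s. exp (- k * s) * f s) has_real_derivative 0) (at s)" for s
    by (rule derivative_eq_intros deriv refl | simp)+
  then have "exp (- k * s) * f s = exp (- k * 0) * f 0"
    by (intro DERIV_isconst_all) blast
  with init show ?thesis by simp
qed

text \<open>
  The five forms that cut out \<open>S5\<close> vanish at time \<open>0\<close> and obey linear equations among themselves
  along an integral curve, into which neither \<open>A\<close> nor \<open>B\<close> enters except through \<open>A + B\<close>.  Each field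
  needs its own way of decoupling them into scalar equations.
\<close>

lemma flow_preserves_S5:
  assumes flow: "is_flow V \<phi>" and V: "V \<in> {V1, V2, V3, V4, V5, V6}" and c: "c \<in> S5"
  shows "\<phi> s c \<in> S5"
proof -
  define A where "A = (\<lambda>s. fst (\<phi> s c))"
  define B where "B = (\<lambda>s. fst (snd (\<phi> s c)))"
  define C where "C = (\<lambda>s. fst (snd (snd (\<phi> s c))))"
  define \<alpha> where "\<alpha> = (\<lambda>s. fst (snd (snd (snd (\<phi> s c)))))"
  define \<beta> where "\<beta> = (\<lambda>s. fst (snd (snd (snd (snd (\<phi> s c))))))"
  define \<gamma> where "\<gamma> = (\<lambda>s. snd (snd (snd (snd (snd (\<phi> s c))))))"
  note coord_defs = A_def B_def C_def \<alpha>_def \<beta>_def \<gamma>_def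
  have \<phi>: "\<phi> s c = (A s, B s, C s, \<alpha> s, \<beta> s, \<gamma> s)" for s
    by (simp add: coord_defs)
  have init: "A 0 + B 0 = 0" "C 0 = 0" "\<alpha> 0 = 0" "\<beta> 0 = 0" "\<gamma> 0 = 0"
    using flow c by (auto simp: coord_defs is_flow_def S5_def)
  have deriv: "((\<lambda>s. \<phi> s c) has_vector_derivative V (\<phi> s c)) (at s)" for s
    using flow unfolding is_flow_def by blast
  have D: "(A has_real_derivative fst (V (\<phi> s c))) (at s)"
    "(B has_real_derivative fst (snd (V (\<phi> s c)))) (at s)"
    "(C has_real_derivative fst (snd (snd (V (\<phi> s c))))) (at s)"
    "(\<alpha> has_real_derivative fst (snd (snd (snd (V (\<phi> s c)))))) (at s)"
    "(\<beta> has_real_derivative fst (snd (snd (snd (snd (V (\<phi> s c))))))) (at s)"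
    "(\<gamma> has_real_derivative snd (snd (snd (snd (snd (V (\<phi> s c))))))) (at s)" for s
    unfolding coord_defs has_real_derivative_iff_has_vector_derivative
    by (intro bounded_linear.has_vector_derivative[OF bounded_linear_fst]
        bounded_linear.has_vector_derivative[OF bounded_linear_snd] deriv)+
  have AB: "((\<lambda>s. A s + B s) has_real_derivative
      fst (V (\<phi> s c)) + fst (snd (V (\<phi> s c)))) (at s)" for s
    by (intro DERIV_add D)
  have zero: "\<gamma> s = 0 \<and> \<alpha> s = 0 \<and> \<beta> s = 0 \<and> C s = 0 \<and> A s + B s = 0" for s
  proof -
    consider "V = V1 \<or> V = V2" | "V = V3" | "V = V4" | "V = V5" | "V = V6"
      using V by blast
    then show ?thesis
    proof cases
      case 1
      \<comment> \<open>The translations act nilpotently: each form in the order \<open>\<gamma>\<close>, \<open>\<alpha>\<close>, \<open>\<beta>\<close>, \<open>C\<close>, \<open>A + B\<close> is driven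
        only by those before it.\<close>
      have \<gamma>: "\<gamma> s = 0" for s
        by (rule zero_if_deriv_proportional[of \<gamma> 0])
          (use D(6) init 1 in \<open>auto simp: \<phi> V1_def V2_def\<close>)
      have \<alpha>: "\<alpha> s = 0" for s
        by (rule zero_if_deriv_proportional[of \<alpha> 0])
          (use D(4) init 1 in \<open>auto simp: \<phi> V1_def V2_def \<gamma>\<close>)
      have \<beta>: "\<beta> s = 0" for s
        by (rule zero_if_deriv_proportional[of \<beta> 0])
          (use D(5) init 1 in \<open>auto simp: \<phi> V1_def V2_def \<gamma>\<close>)
      have C: "C s = 0" for s
        by (rule zero_if_deriv_proportional[of C 0])
          (use D(3) init 1 in \<open>auto simp: \<phi> V1_def V2_def \<alpha> \<beta>\<close>)
      have "A s + B s = 0" for s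
        by (rule zero_if_deriv_proportional[of "\<lambda>s. A s + B s" 0])
          (use AB init 1 in \<open>auto simp: \<phi> V1_def V2_def \<alpha> \<beta>\<close>)
      with \<gamma> \<alpha> \<beta> C show ?thesis by blast
    next
      case 2
      \<comment> \<open>In null directions the boost is diagonal: \<open>\<alpha> \<plusminus> \<beta>\<close> have weights \<open>1, -1\<close> and
        \<open>A + B \<plusminus> 2 C\<close> have weights \<open>2, -2\<close>.\<close>
      have \<gamma>: "\<gamma> s = 0"
        by (rule zero_if_deriv_proportional[of \<gamma> 0])
          (use D(6) init in \<open>auto simp: 2 \<phi> V3_def\<close>)
      have p: "\<alpha> s + \<beta> s = 0"
        by (rule zero_if_deriv_proportional[of "\<lambda>s. \<alpha> s + \<beta> s" 1])
          (use DERIV_add[OF D(4) D(5)] init in \<open>auto simp: 2 \<phi> V3_def add.commute\<close>)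
      have m: "\<alpha> s - \<beta> s = 0"
        by (rule zero_if_deriv_proportional[of "\<lambda>s. \<alpha> s - \<beta> s" "- 1"])
          (use DERIV_diff[OF D(4) D(5)] init in \<open>auto simp: 2 \<phi> V3_def\<close>)
      have P: "A s + B s + 2 * C s = 0"
        by (rule zero_if_deriv_proportional[of "\<lambda>s. A s + B s + 2 * C s" 2])
          (use DERIV_add[OF AB DERIV_cmult[OF D(3), of 2]] init
            in \<open>auto simp: 2 \<phi> V3_def algebra_simps\<close>)
      have M: "A s + B s - 2 * C s = 0"
        by (rule zero_if_deriv_proportional[of "\<lambda>s. A s + B s - 2 * C s" "- 2"])
          (use DERIV_diff[OF AB DERIV_cmult[OF D(3), of 2]] init
            in \<open>auto simp: 2 \<phi> V3_def algebra_simps\<close>)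
      from \<gamma> p m P M show ?thesis by auto
    next
      case 3
      have "\<gamma> s = 0"
        by (rule zero_if_deriv_proportional[of \<gamma> 0])
          (use D(6) init in \<open>auto simp: 3 \<phi> V4_def\<close>)
      moreover have "\<alpha> s = 0"
        by (rule zero_if_deriv_proportional[of \<alpha> 1])
          (use D(4) init in \<open>auto simp: 3 \<phi> V4_def\<close>)
      moreover have "\<beta> s = 0"
        by (rule zero_if_deriv_proportional[of \<beta> 1])
          (use D(5) init in \<open>auto simp: 3 \<phi> V4_def\<close>)
      moreover have "C s = 0"
        by (rule zero_if_deriv_proportional[of C 2])
          (use D(3) init in \<open>auto simp: 3 \<phi> V4_def\<close>)
      moreover have "A s + B s = 0"
        by (rule zero_if_deriv_proportional[of "\<lambda>s. A s + B s" 2])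
          (use AB init in \<open>auto simp: 3 \<phi> V4_def algebra_simps\<close>)
      ultimately show ?thesis by blast
    next
      case 4
      have "\<gamma> s = 0"
        by (rule zero_if_deriv_proportional[of \<gamma> 0])
          (use D(6) init in \<open>auto simp: 4 \<phi> V5_def\<close>)
      moreover have "\<alpha> s = 0"
        by (rule zero_if_deriv_proportional[of \<alpha> 0])
          (use D(4) init in \<open>auto simp: 4 \<phi> V5_def\<close>)
      moreover have "\<beta> s = 0"
        by (rule zero_if_deriv_proportional[of \<beta> 0])
          (use D(5) init in \<open>auto simp: 4 \<phi> V5_def\<close>)
      moreover have "C s = 0"
        by (rule zero_if_deriv_proportional[of C 0])
          (use D(3) init in \<open>auto simp: 4 \<phi> V5_def\<close>)
      moreover have "A s + B s = 0"
        by (rule zero_if_deriv_proportional[of "\<lambda>s. A s + B s" 0])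
          (use AB init in \<open>auto simp: 4 \<phi> V5_def\<close>)
      ultimately show ?thesis by blast
    next
      case 5
      have "\<gamma> s = 0"
        by (rule zero_if_deriv_proportional[of \<gamma> 1])
          (use D(6) init in \<open>auto simp: 5 \<phi> V6_def\<close>)
      moreover have "\<alpha> s = 0"
        by (rule zero_if_deriv_proportional[of \<alpha> 1])
          (use D(4) init in \<open>auto simp: 5 \<phi> V6_def\<close>)
      moreover have "\<beta> s = 0"
        by (rule zero_if_deriv_proportional[of \<beta> 1])
          (use D(5) init in \<open>auto simp: 5 \<phi> V6_def\<close>)
      moreover have "C s = 0"
        by (rule zero_if_deriv_proportional[of C 1])
          (use D(3) init in \<open>auto simp: 5 \<phi> V6_def\<close>)
      moreover have "A s + B s = 0"
        by (rule zero_if_deriv_proportional[of "\<lambda>s. A s + B s" 1])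
          (use AB init in \<open>auto simp: 5 \<phi> V6_def\<close>)
      ultimately show ?thesis by blast
    qed
  qed
  show ?thesis
    using zero[of s] by (simp add: S5_def \<phi>)
qed

text \<open>
  Invariance under a one-parameter group comes as inclusions \<open>f ` S \<subseteq> S\<close>; having it also for the
  inverse upgrades this to equality, which is the form inherited by inverses of group elements.
\<close>

lemma image_eq_if_right_inverse:
  assumes "f ` S \<subseteq> S" and "g ` S \<subseteq> S" and "\<And>x. f (g x) = x"
  shows "f ` S = S"
  using assms by (metis image_eqI image_subset_iff subsetI subset_antisym)

lemma generator_image_S5:
  assumes "g \<in> G_M_generators"
  shows "g ` S5 = S5"
proof -
  consider (flow) V \<phi> s where "V \<in> {V1, V2, V3, V4, V5, V6}" "is_flow V \<phi>" "g = \<phi> s"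
    | (reflection) "g \<in> {R0, R1, R2}"
    using assms unfolding G_M_generators_def by blast
  then show ?thesis
  proof cases
    case flow
    have "\<phi> s (\<phi> (- s) x) = x" for x
      using flow(2) unfolding is_flow_def by (metis add.right_inverse)
    then show ?thesis
      unfolding flow(3)
      by (intro image_eq_if_right_inverse[where g = "\<phi> (- s)"])
        (use flow_preserves_S5[OF flow(2,1)] in auto)
  next
    case reflection
    then show ?thesis
      by (intro image_eq_if_right_inverse[where g = g])
        (auto simp: R0_def R1_def R2_def S5_def)
  qed
qed

text \<open>
  A subset fixed setwise by permutations remains so under the group they generate, because its
  setwise stabiliser is a subgroup.
\<close>

lemma generate_BijGroup_image_eq:
  assumes bij: "H \<subseteq> Bij UNIV" and stab: "\<And>h. h \<in> H \<Longrightarrow> h ` S = S"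
    and g: "g \<in> generate (BijGroup UNIV) H"
  shows "g ` S = S"
proof -
  have "g \<in> Bij UNIV \<and> g ` S = S"
    using g
  proof (induction rule: generate.induct)
    case one
    show ?case by (simp add: BijGroup_def Bij_def bij_id[unfolded id_def])
  next
    case (incl h)
    with bij stab show ?case by blast
  next
    case (inv h)
    then have h: "h \<in> Bij UNIV" "bij h" using bij by (auto simp: Bij_def)
    have "inv_into UNIV h ` S = inv_into UNIV h ` h ` S" using stab[OF inv] by simp
    also have "\<dots> = S" using h(2) by (simp add: image_inv_f_f bij_is_inj)
    finally have "inv_into UNIV h ` S = S" .
    moreover have "inv_into UNIV h \<in> Bij UNIV" using h(2) by (simp add: Bij_def bij_imp_bij_inv)
    ultimately show ?case using inv_BijGroup[OF h(1)] by (simp add: restrict_def)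
  next
    case (eng h1 h2)
    then have "h1 \<circ> h2 \<in> Bij UNIV" unfolding Bij_def by (auto intro: bij_comp)
    moreover have "(h1 \<circ> h2) ` S = S"
      using eng.IH by (simp only: image_comp[symmetric])
    moreover have "h1 \<otimes>\<^bsub>BijGroup UNIV\<^esub> h2 = h1 \<circ> h2"
      using eng.IH by (simp add: BijGroup_def compose_def fun_eq_iff)
    ultimately show ?case by (simp only:)
  qed
  then show ?thesis by blast
qed

lemma G_M_generators_subset_Bij: "G_M_generators \<subseteq> Bij UNIV"
proof
  fix g assume "g \<in> G_M_generators"
  then consider V \<phi> s where "is_flow V \<phi>" "g = \<phi> s" | "g \<in> {R0, R1, R2}"
    unfolding G_M_generators_def by blast
  then have "bij g"
  proof cases
    case 1
    then have "\<phi> (- s) (\<phi> s x) = x" "\<phi> s (\<phi> (- s) x) = x" for x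
      unfolding is_flow_def by (metis add.left_inverse, metis add.right_inverse)
    then show ?thesis
      unfolding \<open>g = \<phi> s\<close> by (intro o_bij[of "\<phi> (- s)"] ext) auto
  next
    case 2
    then show ?thesis
      by (intro o_bij[of g]) (auto simp: R0_def R1_def R2_def fun_eq_iff)
  qed
  then show "g \<in> Bij UNIV" by (simp add: Bij_def)
qed

section \<open>The orbit\<close>

lemma S5_is_orbit: "S5 \<in> orbits G_M UNIV (\<lambda>g. g)"
proof -
  have "orbit G_M (\<lambda>g. g) 0 = S5"
  proof
    show "orbit G_M (\<lambda>g. g) 0 \<subseteq> S5"
    proof
      fix c assume "c \<in> orbit G_M (\<lambda>g. g) 0"
      then obtain g where g: "g \<in> generate (BijGroup UNIV) G_M_generators" and c: "c = g 0"
        by (auto simp: orbit_def G_M_def)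
      have "g ` S5 = S5"
        by (rule generate_BijGroup_image_eq[OF G_M_generators_subset_Bij generator_image_S5 g])
      then show "c \<in> S5" using subspace_0[OF subspace_S5] c by blast
    qed
  next
    show "S5 \<subseteq> orbit G_M (\<lambda>g. g) 0"
    proof
      fix c assume "c \<in> S5"
      then obtain \<tau> where c: "c = (\<tau>, - \<tau>, 0, 0, 0, 0)" by (auto simp: S5_eq_range)
      define g :: "killing_coords \<Rightarrow> killing_coords"
        where "g = (\<lambda>(A, B, C, \<alpha>, \<beta>, \<gamma>). (A + \<tau>, B - \<tau>, C, \<alpha>, \<beta>, \<gamma>))"
      have "g \<in> G_M_generators"
        unfolding G_M_generators_def g_def
        by (intro UnI1 CollectI exI[of _ V5] exI[of _ \<tau>] exI conjI, rule refl)
          (simp, rule is_flow_V5)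
      then have "g \<in> carrier G_M"
        by (simp add: G_M_def generate.incl)
      moreover have "g 0 = c" by (simp add: g_def c zero_prod_def)
      ultimately show "c \<in> orbit G_M (\<lambda>g. g) 0" by (auto simp: orbit_def)
    qed
  qed
  then show ?thesis unfolding orbits_def by blast
qed

theorem proposition28:
  shows "subspace S5 \<and> dim S5 = 1 \<and>
    killing_tensor ` S5 = range (\<lambda>\<tau> :: real. \<lambda>p :: real^2. \<tau> *\<^sub>R metric_contra) \<and>
    (\<forall>c\<in>S5. \<not> characteristic (killing_tensor c)) \<and>
    connected S5 \<and>
    S5 \<in> orbits G_M UNIV (\<lambda>g. g)"
proof (intro conjI ballI)
  fix c assume "c \<in> S5"
  then obtain \<tau> where "c = (\<tau>, - \<tau>, 0, 0, 0, 0)" by (auto simp: S5_eq_range)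
  then show "\<not> characteristic (killing_tensor c)"
    by (simp only: killing_tensor_metric not_characteristic_metric not_False_eq_True)
qed (fact subspace_S5 dim_S5 killing_tensor_image_S5 connected_S5 S5_is_orbit)+

end
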